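(* Let $c_0(\cdot,\cdot)$ be the solution to the Carr–Penrose (CP) system with Gaussian initial data, i.e. $c_0(x,0)=K_0\exp[-A_0(x+B_0)^2]$ for $x>0$, where $K_0,A_0>0$ and $B_0\in\mathbb{R}$ are constants with $\int_0^\infty xc_0(x,0)\,dx=1$, and let $$\Lambda_0(t)=\int_0^\infty xc_0(x,t)\,dx\Big/\int_0^\infty c_0(x,t)\,dx .$$ Then there exist $t_0>2$ and constants $C_1,C_2>0$ such that $$1-\frac{C_1}{\log t}\ \le\ \frac{d\Lambda_0(t)}{dt}\ \le\ 1-\frac{C_2}{\log t}\qquad\text{for } t\ge t_0 .$$
   Context: The CP system for a density $c_0(x,t)\ge0$, $x>0$, $t\ge0$, is $$\frac{\partial c_0(x,t)}{\partial t}=\frac{\partial}{\partial x}\Big[\Big(1-\frac{x}{\Lambda_0(t)}\Big)c_0(x,t)\Big],\quad x>0,\qquad \int_0^\infty x\,c_0(x,t)\,dx=1\quad (t\ge0),$$ where $\Lambda_0(t)>0$ is determined by the conservation law, so that it is given by the formula in the statement. Equivalently, with $m_1(t)=\exp[\int_0^t ds/\Lambda_0(s)]$, $m_2(t)=\int_0^t\exp[\int_s^tds'/\Lambda_0(s')]ds$ and $w_0(x,t)=\int_x^\infty c_0(x',t)dx'$, one has $w_0(x,t)=w_0\big((x+m_2(t))/m_1(t),0\big)$ for $x,t\ge0$, with $\Lambda_0:[0,\infty)\to(0,\infty)$ continuous and such that $\int_0^\infty w_0(x,t)\,dx=1$ for all $t\ge0$. *)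

theory Defs
  imports "HOL-Analysis.Analysis"
begin

text \<open>
  A density is a function \<open>c x t\<close> of position \<open>x > 0\<close> and time \<open>t \<ge> 0\<close>; its values outside
  this range play no role.
\<close>

definition CP_mean :: "(real \<Rightarrow> real \<Rightarrow> real) \<Rightarrow> real \<Rightarrow> real"  where
  "CP_mean c t =
     (LINT x:{0<..}|lborel. x * c x t) / (LINT x:{0<..}|lborel. c x t)"

text \<open>
  Classical solutions of the Carr--Penrose system. The rate \<open>\<Lambda>\<close> in the equation is not an
  independent unknown: the conservation law forces it to be the mean cluster size.
  Joint differentiability is the regularity required of a classical solution; at \<open>t = 0\<close> the
  time derivative is one-sided. The integrability conditions are needed because the
  Lebesgue integral of a non-integrable function is \<open>0\<close> by convention.
\<close>

definition CP_solution :: "(real \<Rightarrow> real \<Rightarrow> real) \<Rightarrow> bool"  where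
  "CP_solution c \<longleftrightarrow>
     (\<forall>x>0. \<forall>t\<ge>0. 0 \<le> c x t) \<and>
     (\<forall>t\<ge>0. set_integrable lborel {0<..} (\<lambda>x. c x t)) \<and>
     (\<forall>t\<ge>0. set_integrable lborel {0<..} (\<lambda>x. x * c x t)) \<and>
     (\<forall>t\<ge>0. (LINT x:{0<..}|lborel. x * c x t) = 1) \<and>
     (\<forall>t\<ge>0. 0 < CP_mean c t) \<and>
     continuous_on {0..} (CP_mean c) \<and>
     (\<lambda>(x, t). c x t) differentiable_on ({0<..} \<times> {0..}) \<and>
     (\<forall>x>0. \<forall>t\<ge>0. \<exists>D.
        ((\<lambda>s. c x s) has_real_derivative D) (at t within {0..}) \<and>
        ((\<lambda>y. (1 - y / CP_mean c t) * c y t) has_real_derivative D) (at x))"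

end

theory Submission
  imports Defs "HOL-Probability.Distributions" "HOL-Real_Asymp.Real_Asymp"
begin

text \<open>
  The equation transports and dilates the initial density. Along a characteristic
  \<open>x' = x / \<Lambda>\<^sub>0 - 1\<close> the density decays at rate \<open>1 / \<Lambda>\<^sub>0\<close>, so with \<open>m = exp (\<integral> 1 / \<Lambda>\<^sub>0)\<close> and
  \<open>\<beta> = B\<^sub>0 + \<integral> 1 / m\<close> a Gaussian initial datum stays a piece of a Gaussian
  (\<open>solution_by_characteristics\<close>):
  \<open>c\<^sub>0(x, t) = (K\<^sub>0 / m) exp (- A\<^sub>0 (x / m + \<beta>)\<^sup>2)\<close>.
  Hence the whole evolution is encoded in the cutoff \<open>\<beta>(t)\<close>. Write \<open>g = exp (- A\<^sub>0 b\<^sup>2)\<close>, let \<open>T\<close> be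
  the tail \<open>\<integral>\<^sub>b\<^sup>\<infinity> exp (- A\<^sub>0 v\<^sup>2) dv\<close> and \<open>E\<close> the integrated tail \<open>\<integral>\<^sub>b\<^sup>\<infinity> (v - b) exp (- A\<^sub>0 v\<^sup>2) dv\<close>, so that
  \<open>E' = - T\<close> and \<open>T' = - g\<close>. The total number of clusters is \<open>K\<^sub>0 T(\<beta>)\<close> and the
  conservation law reads \<open>K\<^sub>0 m E(\<beta>) = 1\<close>. Therefore \<open>\<Lambda>\<^sub>0 = 1 / (K\<^sub>0 T(\<beta>))\<close>, the cutoff
  solves the autonomous equation \<open>\<beta>' = K\<^sub>0 E(\<beta>)\<close>, and
  \<open>\<Lambda>\<^sub>0' = g E / T\<^sup>2 = E E'' / E'\<^sup>2\<close>, all evaluated at \<open>b = \<beta>(t)\<close>.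

  The quotient \<open>E E'' / E'\<^sup>2\<close> would be \<open>1\<close> for an exponential tail; for a Gaussian one the
  asymptotic series of \<open>T\<close> in powers of \<open>\<epsilon> = 1 / (2 A\<^sub>0 b\<^sup>2)\<close> gives \<open>1 - \<epsilon> + O(\<epsilon>\<^sup>2)\<close>. This is
  \<open>gaussian_excess_log_concavity\<close>, in the explicit form
  \<open>1 - 3 \<epsilon> \<le> E E'' / E'\<^sup>2 \<le> 1 - \<epsilon> / 2\<close>. The leading term of \<open>b T\<close> cancels in
  \<open>E = g / (2 A\<^sub>0) - b T\<close>, so \<open>T\<close> has to be controlled to two further orders.

  It remains to compare \<open>\<epsilon>\<close> with \<open>1 / ln t\<close>. The cutoff tends to infinity, because \<open>\<beta>'\<close> would
  otherwise stay bounded away from zero (\<open>cutoff_at_top\<close>). So \<open>\<Lambda>\<^sub>0'\<close> is eventually between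
  \<open>1 / 2\<close> and \<open>1\<close>, which makes \<open>\<Lambda>\<^sub>0\<close> comparable to \<open>t\<close> (\<open>mean_linear_growth\<close>). On the other hand
  \<open>ln \<Lambda>\<^sub>0 = - ln (K\<^sub>0 T(\<beta>)) \<sim> A\<^sub>0 \<beta>\<^sup>2\<close>, and thus \<open>A\<^sub>0 \<beta>\<^sup>2\<close> and \<open>ln t\<close> agree up to a factor \<open>2\<close>
  (\<open>cutoff_log_growth\<close>).
\<close>

section \<open>Gaussian tails\<close>
definition gaussian_tail :: "real \<Rightarrow> real \<Rightarrow> real" where
  "gaussian_tail a b = (LINT v:{b<..}|lborel. exp (- a * v\<^sup>2))"

definition gaussian_excess :: "real \<Rightarrow> real \<Rightarrow> real" where
  "gaussian_excess a b = (LINT v:{b<..}|lborel. (v - b) * exp (- a * v\<^sup>2))"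

lemma integrable_gaussian:
  assumes "0 < (a::real)"
  shows "integrable lborel (\<lambda>v. exp (- a * v\<^sup>2))"
    and "integrable lborel (\<lambda>v. v * exp (- a * v\<^sup>2))"
proof -
  define \<sigma> where "\<sigma> = 1 / sqrt (2 * a)"
  define C where "C = sqrt (2 * pi * \<sigma>\<^sup>2)"
  have \<sigma>: "\<sigma>\<^sup>2 = 1 / (2 * a)" "0 < \<sigma>" using assms by (auto simp: \<sigma>_def power_divide)
  have nd: "exp (- a * v\<^sup>2) = C * normal_density 0 \<sigma> v" for v
    using \<sigma> assms by (simp add: normal_density_def C_def)
  show "integrable lborel (\<lambda>v. exp (- a * v\<^sup>2))"
    unfolding nd using \<sigma> by (intro integrable_mult_right integrable_normal_density)
  have "integrable lborel (\<lambda>v. C * (normal_density 0 \<sigma> v * v))"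
    using \<sigma> by (intro integrable_mult_right integrable_normal_moment_nz_1)
  then show "integrable lborel (\<lambda>v. v * exp (- a * v\<^sup>2))"
    unfolding nd by (simp add: mult_ac)
qed

lemma set_integrable_gaussian:
  assumes "0 < (a::real)" "S \<in> sets lborel"
  shows "set_integrable lborel S (\<lambda>v. exp (- a * v\<^sup>2))"
    and "set_integrable lborel S (\<lambda>v. v * exp (- a * v\<^sup>2))"
  unfolding set_integrable_def
  by (intro integrable_mult_indicator integrable_gaussian assms)+

lemma gaussian_first_moment_tail:
  fixes a b :: real assumes "0 < a"
  shows "(LINT v:{b<..}|lborel. v * exp (- a * v\<^sup>2)) = exp (- a * b\<^sup>2) / (2 * a)"
proof -
  let ?F = "\<lambda>v. - exp (- a * v\<^sup>2) / (2 * a)"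
  have "(LBINT v=ereal b..\<infinity>. v * exp (- a * v\<^sup>2)) = 0 - ?F b"
  proof (rule interval_integral_FTC_integrable[where F = ?F])
    show "(?F has_vector_derivative x * exp (- a * x\<^sup>2)) (at x)" for x
      using assms unfolding has_real_derivative_iff_has_vector_derivative[symmetric]
      by (auto intro!: derivative_eq_intros simp: field_simps)
    show "isCont (\<lambda>v. v * exp (- a * v\<^sup>2)) x" for x
      by (intro continuous_intros)
    show "set_integrable lborel (einterval (ereal b) \<infinity>) (\<lambda>v. v * exp (- a * v\<^sup>2))"
      by (simp add: set_integrable_gaussian[OF assms, simplified])
    have "(?F \<longlongrightarrow> ?F b) (at_right b)"
      using assms by (intro tendsto_intros) auto
    then show "((?F \<circ> real_of_ereal) \<longlongrightarrow> ?F b) (at_right (ereal b))"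
      by (simp add: ereal_tendsto_simps)
    have "(?F \<longlongrightarrow> 0) at_top"
      using assms by real_asymp
    then show "((?F \<circ> real_of_ereal) \<longlongrightarrow> 0) (at_left \<infinity>)"
      by (simp add: ereal_tendsto_simps)
  qed simp
  then show ?thesis by (simp add: interval_integral_to_infinity_eq)
qed

text \<open>
  Only the first moment of the tail is elementary; this identity expresses the integrated
  tail through it, so that every later estimate concerns the tail alone.
\<close>
lemma gaussian_excess_eq:
  assumes "0 < a"
  shows "gaussian_excess a b = exp (- a * b\<^sup>2) / (2 * a) - b * gaussian_tail a b"
proof -
  have "gaussian_excess a b =
      (LINT v:{b<..}|lborel. v * exp (- a * v\<^sup>2) - b * exp (- a * v\<^sup>2))"
    by (simp add: gaussian_excess_def left_diff_distrib)
  also have "\<dots> = (LINT v:{b<..}|lborel. v * exp (- a * v\<^sup>2)) - b * gaussian_tail a b"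
    unfolding gaussian_tail_def
    by (subst set_integral_diff)
       (auto intro!: set_integrable_mult_right set_integrable_gaussian[OF assms, simplified])
  finally show ?thesis by (simp only: gaussian_first_moment_tail[OF assms])
qed

lemma gaussian_tail_has_derivative:
  assumes "0 < a"
  shows "(gaussian_tail a has_real_derivative - exp (- a * b\<^sup>2)) (at b)"
proof -
  let ?g = "\<lambda>v::real. exp (- a * v\<^sup>2)"
  have split: "gaussian_tail a x = gaussian_tail a (b - 1) - integral {b - 1..x} ?g"
    if "b - 1 \<le> x" for x
  proof -
    have "{b - 1<..} = {b - 1<..x} \<union> {x<..}" using that by auto
    then have "gaussian_tail a (b - 1) = (LINT v:{b - 1<..x} \<union> {x<..}|lborel. ?g v)"
      by (simp add: gaussian_tail_def)
    also have "\<dots> = (LINT v:{b - 1<..x}|lborel. ?g v) + gaussian_tail a x"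
      unfolding gaussian_tail_def
      by (intro set_integral_Un set_integrable_gaussian assms) auto
    also have "(LINT v:{b - 1<..x}|lborel. ?g v) = (LINT v:{b - 1..x}|lborel. ?g v)"
      using that interval_integral_Icc interval_integral_Ioc by metis
    also have "\<dots> = integral {b - 1..x} ?g"
      by (intro set_borel_integral_eq_integral set_integrable_gaussian assms) auto
    finally show ?thesis by simp
  qed
  have "((\<lambda>x. integral {b - 1..x} ?g) has_real_derivative ?g b) (at b within {b - 1..b + 1})"
    by (intro integral_has_real_derivative continuous_intros) auto
  then have "((\<lambda>x. integral {b - 1..x} ?g) has_real_derivative ?g b) (at b)"
    by (simp add: at_within_Icc_at)
  then have "((\<lambda>x. gaussian_tail a (b - 1) - integral {b - 1..x} ?g)
      has_real_derivative - ?g b) (at b)"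
    by (auto intro!: derivative_eq_intros)
  moreover have "\<forall>\<^sub>F x in nhds b. gaussian_tail a x =
      gaussian_tail a (b - 1) - integral {b - 1..x} ?g"
    using eventually_nhds_in_open[of "{b - 1<..}" b, simplified] by eventually_elim (rule split, simp)
  ultimately show ?thesis
    by (subst DERIV_cong_ev[OF refl _ refl]) auto
qed

lemma gaussian_excess_has_derivative:
  assumes "0 < a"
  shows "(gaussian_excess a has_real_derivative - gaussian_tail a b) (at b)"
proof -
  have "((\<lambda>x. exp (- a * x\<^sup>2) / (2 * a) - x * gaussian_tail a x) has_real_derivative
      - gaussian_tail a b) (at b)"
    using assms
    by (auto intro!: derivative_eq_intros gaussian_tail_has_derivative simp: field_simps)
  then show ?thesis by (simp only: gaussian_excess_eq[OF assms, abs_def])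
qed

lemma gaussian_tail_pos:
  assumes "0 < a" shows "0 < gaussian_tail a b"
proof -
  have "gaussian_tail a (b + 1) < gaussian_tail a b"
    by (rule DERIV_neg_imp_decreasing) 
       (use gaussian_tail_has_derivative[OF assms] in \<open>auto intro!: exI[of _ "- exp (- a * x\<^sup>2)" for x]\<close>)
  moreover have "0 \<le> gaussian_tail a (b + 1)"
    unfolding gaussian_tail_def set_lebesgue_integral_def
    by (intro Bochner_Integration.integral_nonneg) (auto simp: indicator_def)
  ultimately show ?thesis by simp
qed

lemma gaussian_excess_strict_antimono:
  assumes "0 < a" "x < y" shows "gaussian_excess a y < gaussian_excess a x"
proof (rule DERIV_neg_imp_decreasing[OF assms(2)])
  show "\<exists>D. (gaussian_excess a has_real_derivative D) (at z) \<and> D < 0" for z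
    using gaussian_excess_has_derivative[OF assms(1)] gaussian_tail_pos[OF assms(1)]
    by (intro exI[of _ "- gaussian_tail a z"]) simp
qed

text \<open>
  A strictly decreasing function that is nonnegative everywhere has no zero; the same argument
  gives the positivity of the tail.
\<close>
lemma gaussian_excess_pos:
  assumes "0 < a" shows "0 < gaussian_excess a b"
proof -
  have "gaussian_excess a (b + 1) < gaussian_excess a b"
    using assms by (intro gaussian_excess_strict_antimono) auto
  moreover have "0 \<le> gaussian_excess a (b + 1)"
    unfolding gaussian_excess_def set_lebesgue_integral_def
    by (intro Bochner_Integration.integral_nonneg) (auto simp: indicator_def)
  ultimately show ?thesis by simp
qed

text \<open>
  Positivity of the integrated tail bounds \<open>b * gaussian_tail a b\<close> by \<open>exp (- a b\<^sup>2) / (2 a)\<close>,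
  which decays.
\<close>
lemma gaussian_tail_tendsto_0:
  assumes "0 < a" shows "(gaussian_tail a \<longlongrightarrow> 0) at_top"
proof (rule tendsto_sandwich[where f = "\<lambda>_. 0"])
  show "((\<lambda>b. exp (- a * b\<^sup>2) / (2 * a * b)) \<longlongrightarrow> 0) at_top"
    using assms by real_asymp
  show "\<forall>\<^sub>F b in at_top. gaussian_tail a b \<le> exp (- a * b\<^sup>2) / (2 * a * b)"
    using eventually_gt_at_top[of 0]
  proof eventually_elim
    case (elim b)
    then show ?case
      using gaussian_excess_pos[OF assms, of b] assms
      by (simp add: gaussian_excess_eq field_simps)
  qed
qed (auto intro!: always_eventually less_imp_le gaussian_tail_pos[OF assms])

text \<open>Turns a comparison of derivatives into a comparison of two functions that vanish at infinity.\<close>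
lemma nonpos_if_nondecreasing_to_0:
  fixes f :: "real \<Rightarrow> real"
  assumes der: "\<And>x. b \<le> x \<Longrightarrow> (f has_real_derivative f' x) (at x)"
    and "\<And>x. b \<le> x \<Longrightarrow> 0 \<le> f' x" and lim: "(f \<longlongrightarrow> 0) at_top"
  shows "f b \<le> 0"
proof (rule tendsto_lowerbound[OF lim])
  show "\<forall>\<^sub>F x in at_top. f b \<le> f x"
    using eventually_ge_at_top[of b]
    by eventually_elim (rule DERIV_nonneg_imp_nondecreasing, use assms in auto)
qed simp

text \<open>
  Repeated integration by parts expands the tail into an alternating asymptotic series whose
  partial sums are alternately too large and too small. Differentiating a partial sum
  telescopes to \<open>- exp (- a x\<^sup>2)\<close> and one remainder of known sign, which decides the direction
  of the inequality.
\<close>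
lemma gaussian_tail_bounds:
  assumes a: "0 < a" and b: "0 < b"
  defines "\<epsilon> \<equiv> 1 / (2 * a * b\<^sup>2)"
  shows "gaussian_tail a b \<le> exp (- a * b\<^sup>2) / (2 * a * b) * (1 - \<epsilon> + 3 * \<epsilon>\<^sup>2)"
    and "exp (- a * b\<^sup>2) / (2 * a * b) * (1 - \<epsilon> + 3 * \<epsilon>\<^sup>2 - 15 * \<epsilon> ^ 3) \<le> gaussian_tail a b"
proof -
  (* h and k are the partial sums with three and four terms, as functions of the endpoint. *)
  define h where "h x = exp (- a * x\<^sup>2) * (1 / (2 * a * x) - 1 / (4 * a\<^sup>2 * x ^ 3) + 3 / (8 * a ^ 3 * x ^ 5))"
    for x :: real
  define k where "k x = h x - exp (- a * x\<^sup>2) * (15 / (16 * a ^ 4 * x ^ 7))" for x :: real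
  have h_terms: "1 / (4 * a\<^sup>2 * b ^ 3) = 1 / (2 * a * b) * \<epsilon>"
      "3 / (8 * a ^ 3 * b ^ 5) = 1 / (2 * a * b) * (3 * \<epsilon>\<^sup>2)"
      "15 / (16 * a ^ 4 * b ^ 7) = 1 / (2 * a * b) * (15 * \<epsilon> ^ 3)"
    by (simp_all add: \<epsilon>_def power_divide power_mult_distrib eval_nat_numeral mult_ac)
  have h': "(h has_real_derivative - exp (- a * x\<^sup>2) * (1 + 15 / (8 * a ^ 3 * x ^ 6))) (at x)"
    if "0 < x" for x
    unfolding h_def[abs_def] using that a
    apply (auto intro!: derivative_eq_intros)
    apply (simp add: divide_simps power2_eq_square)
    apply (simp add: algebra_simps eval_nat_numeral)
    done
  have k': "(k has_real_derivative - exp (- a * x\<^sup>2) * (1 - 105 / (16 * a ^ 4 * x ^ 8))) (at x)"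
    if "0 < x" for x
    unfolding k_def[abs_def] using that a
    apply (auto intro!: derivative_eq_intros h')
    apply (simp add: divide_simps power2_eq_square)
    apply (simp add: algebra_simps eval_nat_numeral)
    done
  have "gaussian_tail a b - h b \<le> 0"
  proof (rule nonpos_if_nondecreasing_to_0[where f = "\<lambda>x. gaussian_tail a x - h x" and b = b
        and f' = "\<lambda>x. exp (- a * x\<^sup>2) * (15 / (8 * a ^ 3 * x ^ 6))"])
    fix x assume "b \<le> x"
    with b have x: "0 < x" by simp
    show "((\<lambda>x. gaussian_tail a x - h x) has_real_derivative
        exp (- a * x\<^sup>2) * (15 / (8 * a ^ 3 * x ^ 6))) (at x)"
      by (auto intro!: derivative_eq_intros gaussian_tail_has_derivative h' a x simp: algebra_simps)
    show "0 \<le> exp (- a * x\<^sup>2) * (15 / (8 * a ^ 3 * x ^ 6))" using a x by simp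
  next
    have "(h \<longlongrightarrow> 0) at_top" unfolding h_def[abs_def] using a by real_asymp
    from tendsto_diff[OF gaussian_tail_tendsto_0[OF a] this]
    show "((\<lambda>x. gaussian_tail a x - h x) \<longlongrightarrow> 0) at_top" by simp
  qed
  moreover have "h b = exp (- a * b\<^sup>2) / (2 * a * b) * (1 - \<epsilon> + 3 * \<epsilon>\<^sup>2)"
    using a b unfolding h_def h_terms by (simp add: field_simps)
  ultimately show "gaussian_tail a b \<le> exp (- a * b\<^sup>2) / (2 * a * b) * (1 - \<epsilon> + 3 * \<epsilon>\<^sup>2)"
    by simp
  have "k b - gaussian_tail a b \<le> 0"
  proof (rule nonpos_if_nondecreasing_to_0[where f = "\<lambda>x. k x - gaussian_tail a x" and b = b
        and f' = "\<lambda>x. exp (- a * x\<^sup>2) * (105 / (16 * a ^ 4 * x ^ 8))"])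
    fix x assume "b \<le> x"
    with b have x: "0 < x" by simp
    show "((\<lambda>x. k x - gaussian_tail a x) has_real_derivative
        exp (- a * x\<^sup>2) * (105 / (16 * a ^ 4 * x ^ 8))) (at x)"
      by (auto intro!: derivative_eq_intros gaussian_tail_has_derivative k' a x simp: algebra_simps)
    show "0 \<le> exp (- a * x\<^sup>2) * (105 / (16 * a ^ 4 * x ^ 8))" using a x by simp
  next
    have "(k \<longlongrightarrow> 0) at_top" unfolding k_def[abs_def] h_def[abs_def] using a by real_asymp
    from tendsto_diff[OF this gaussian_tail_tendsto_0[OF a]]
    show "((\<lambda>x. k x - gaussian_tail a x) \<longlongrightarrow> 0) at_top" by simp
  qed
  moreover have "k b = exp (- a * b\<^sup>2) / (2 * a * b) * (1 - \<epsilon> + 3 * \<epsilon>\<^sup>2 - 15 * \<epsilon> ^ 3)"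
    using a b unfolding k_def h_def h_terms by (simp add: field_simps)
  ultimately show "exp (- a * b\<^sup>2) / (2 * a * b) * (1 - \<epsilon> + 3 * \<epsilon>\<^sup>2 - 15 * \<epsilon> ^ 3) \<le> gaussian_tail a b"
    by simp
qed

lemma gaussian_tail_coarse_bounds:
  assumes a: "0 < a" and b: "0 < b" and small: "15 \<le> a * b\<^sup>2"
  shows "exp (- a * b\<^sup>2) / (4 * a * b) \<le> gaussian_tail a b"
    and "gaussian_tail a b \<le> exp (- a * b\<^sup>2) / (2 * a * b)"
proof -
  define \<epsilon> where "\<epsilon> = 1 / (2 * a * b\<^sup>2)"
  define q where "q = exp (- a * b\<^sup>2) / (2 * a * b)"
  have q: "0 < q" using a b by (simp add: q_def)
  have \<epsilon>: "0 < \<epsilon>" "\<epsilon> \<le> 1 / 30" using a b small by (auto simp: \<epsilon>_def field_simps)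
  have "\<epsilon>\<^sup>2 \<le> \<epsilon> / 30" using mult_left_mono[OF \<epsilon>(2), of \<epsilon>] \<epsilon>(1) by (simp add: power2_eq_square)
  moreover have "\<epsilon> ^ 3 \<le> \<epsilon>\<^sup>2 / 30"
    using mult_left_mono[OF \<epsilon>(2), of "\<epsilon>\<^sup>2"] by (simp add: eval_nat_numeral mult_ac)
  ultimately have *: "1 / 2 \<le> 1 - \<epsilon> + 3 * \<epsilon>\<^sup>2 - 15 * \<epsilon> ^ 3" "1 - \<epsilon> + 3 * \<epsilon>\<^sup>2 \<le> 1"
    using \<epsilon> zero_le_power2[of \<epsilon>] by linarith+
  show "exp (- a * b\<^sup>2) / (4 * a * b) \<le> gaussian_tail a b"
    using gaussian_tail_bounds(2)[OF a b] mult_left_mono[OF *(1), of q] q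
    by (simp add: \<epsilon>_def q_def)
  show "gaussian_tail a b \<le> exp (- a * b\<^sup>2) / (2 * a * b)"
    using gaussian_tail_bounds(1)[OF a b] mult_left_mono[OF *(2), of q] q
    by (simp add: \<epsilon>_def q_def)
qed

text \<open>
  The quotient \<open>D\<close> is \<open>E E'' / E'\<^sup>2\<close> for \<open>E = gaussian_excess a\<close>, so \<open>1 - D\<close> measures how strictly
  log-concave \<open>E\<close> is. In terms of the ratio \<open>s\<close> of the tail to its leading term,
  \<open>D = (1 - s) / (\<epsilon> s\<^sup>2)\<close>; inserting \<open>s = 1 - \<epsilon> + 3 \<epsilon>\<^sup>2 + O(\<epsilon>\<^sup>3)\<close> yields \<open>D = 1 - \<epsilon> + O(\<epsilon>\<^sup>2)\<close>. The
  division by \<open>\<epsilon>\<close> is what makes the third-order lower bound on \<open>s\<close> necessary. The threshold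
  \<open>15\<close> means \<open>\<epsilon> \<le> 1 / 30\<close>, which turns the error \<open>15 \<epsilon>\<^sup>3\<close> of the lower bound on \<open>s\<close> into
  at most \<open>\<epsilon>\<^sup>2 / 2\<close>.
\<close>
lemma gaussian_excess_log_concavity:
  assumes a: "0 < a" and b: "0 < b" and small: "15 \<le> a * b\<^sup>2"
  defines "D \<equiv> exp (- a * b\<^sup>2) * gaussian_excess a b / (gaussian_tail a b)\<^sup>2"
    and "\<epsilon> \<equiv> 1 / (2 * a * b\<^sup>2)"
  shows "1 - 3 * \<epsilon> \<le> D" "D \<le> 1 - \<epsilon> / 2"
proof -
  define q where "q = exp (- a * b\<^sup>2) / (2 * a * b)"
  define s where "s = gaussian_tail a b / q"
  have q: "0 < q" using a b by (simp add: q_def)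
  have \<epsilon>: "0 < \<epsilon>" "\<epsilon> \<le> 1 / 30" using a b small by (auto simp: \<epsilon>_def field_simps)
  have \<epsilon>2: "\<epsilon>\<^sup>2 \<le> \<epsilon> / 30" using mult_left_mono[OF \<epsilon>(2), of \<epsilon>] \<epsilon>(1) by (simp add: power2_eq_square)
  have \<epsilon>3: "\<epsilon> ^ 3 \<le> \<epsilon>\<^sup>2 / 30"
    using mult_left_mono[OF \<epsilon>(2), of "\<epsilon>\<^sup>2"] by (simp add: eval_nat_numeral mult_ac)
  have \<epsilon>sq: "0 \<le> \<epsilon>\<^sup>2" by simp
  have s_up: "s \<le> 1 - \<epsilon> + 3 * \<epsilon>\<^sup>2"
    using gaussian_tail_bounds(1)[OF a b] q
    unfolding s_def pos_divide_le_eq[OF q] by (simp add: q_def \<epsilon>_def mult_ac)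
  have s_low: "1 - \<epsilon> + 3 * \<epsilon>\<^sup>2 - 15 * \<epsilon> ^ 3 \<le> s"
    using gaussian_tail_bounds(2)[OF a b] q
    unfolding s_def pos_le_divide_eq[OF q] by (simp add: q_def \<epsilon>_def mult_ac)
  have s: "1 - \<epsilon> \<le> s" "s \<le> 1" using s_up s_low \<epsilon> \<epsilon>2 \<epsilon>3 \<epsilon>sq by linarith+
  have "0 < s" using s \<epsilon> by linarith
  have T: "gaussian_tail a b = q * s" using q by (simp add: s_def)
  have E: "gaussian_excess a b = q * b * (1 - s)"
    using a b by (simp add: gaussian_excess_eq T q_def field_simps)
  have "exp (- a * b\<^sup>2) = 2 * a * b * q" using a b by (simp add: q_def)
  then have "D = (1 - s) / (\<epsilon> * s\<^sup>2)"
    using a b q \<open>0 < s\<close> unfolding D_def T E \<epsilon>_def by (simp add: field_simps power2_eq_square)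
  moreover have "(1 - 3 * \<epsilon>) * (\<epsilon> * s\<^sup>2) \<le> 1 - s"
  proof -
    have "s\<^sup>2 \<le> 1" using s \<epsilon> by (simp add: power_le_one)
    then have "(1 - 3 * \<epsilon>) * \<epsilon> * s\<^sup>2 \<le> (1 - 3 * \<epsilon>) * \<epsilon> * 1"
      using \<epsilon> by (intro mult_left_mono) auto
    then show ?thesis using s_up by (simp add: algebra_simps power2_eq_square)
  qed
  moreover have "1 - s \<le> (1 - \<epsilon> / 2) * (\<epsilon> * s\<^sup>2)"
  proof -
    have "(1 - \<epsilon>)\<^sup>2 \<le> s\<^sup>2" using s \<epsilon> by (intro power_mono) auto
    moreover have "(1 - \<epsilon>)\<^sup>2 = 1 + \<epsilon>\<^sup>2 - 2 * \<epsilon>" by (simp add: power2_diff)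
    ultimately have "1 - 2 * \<epsilon> \<le> s\<^sup>2" using \<epsilon>sq by linarith
    then have "(1 - \<epsilon> / 2) * \<epsilon> * (1 - 2 * \<epsilon>) \<le> (1 - \<epsilon> / 2) * \<epsilon> * s\<^sup>2"
      using \<epsilon> by (intro mult_left_mono) auto
    moreover have "(1 - \<epsilon> / 2) * \<epsilon> * (1 - 2 * \<epsilon>) = \<epsilon> - 5 / 2 * \<epsilon>\<^sup>2 + \<epsilon> ^ 3"
      by (simp add: field_simps eval_nat_numeral)
    moreover have "0 \<le> \<epsilon> ^ 3" using \<epsilon> by simp
    ultimately show ?thesis using s_low \<epsilon>3 by (simp only: mult.assoc)
  qed
  ultimately show "1 - 3 * \<epsilon> \<le> D" "D \<le> 1 - \<epsilon> / 2"
    using \<epsilon> \<open>0 < s\<close> by (simp_all add: pos_le_divide_eq pos_divide_le_eq)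
qed

section \<open>The method of characteristics\<close>

text \<open>
  The characteristic through the initial point \<open>y\<close> is
  \<open>X t = dilation c t * (y - displacement c t)\<close>. In particular a cluster disappears when the
  displacement reaches its initial size.
\<close>
definition dilation :: "(real \<Rightarrow> real \<Rightarrow> real) \<Rightarrow> real \<Rightarrow> real" where
  "dilation c t = exp (integral {0..t} (\<lambda>s. 1 / CP_mean c s))"

definition displacement :: "(real \<Rightarrow> real \<Rightarrow> real) \<Rightarrow> real \<Rightarrow> real" where
  "displacement c t = integral {0..t} (\<lambda>s. 1 / dilation c s)"

lemma dilation_pos: "0 < dilation c t"
  by (simp add: dilation_def)

lemma dilation_0: "dilation c 0 = 1" and displacement_0: "displacement c 0 = 0"
  by (simp_all add: dilation_def displacement_def)

lemma integral_has_real_derivative_half_line: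
  fixes f :: "real \<Rightarrow> real"
  assumes "continuous_on {0..} f" "0 \<le> t"
  shows "((\<lambda>x. integral {0..x} f) has_real_derivative f t) (at t within {0..})"
proof -
  have "((\<lambda>x. integral {0..x} f) has_real_derivative f t) (at t within {0..t + 1})"
    using assms by (intro integral_has_real_derivative continuous_on_subset[OF assms(1)]) auto
  moreover have "at t within {0..t + 1} = at t within {0..}"
    by (rule at_within_nhd[of t "{..<t + 1}"]) auto
  ultimately show ?thesis by simp
qed

context
  fixes c :: "real \<Rightarrow> real \<Rightarrow> real"
  assumes sol: "CP_solution c"
begin

lemma mean_pos: "0 \<le> t \<Longrightarrow> 0 < CP_mean c t"
  and mean_continuous: "continuous_on {0..} (CP_mean c)"
  and unit_mass: "0 \<le> t \<Longrightarrow> (LINT x:{0<..}|lborel. x * c x t) = 1"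
  and jointly_differentiable: "(\<lambda>(x, t). c x t) differentiable_on ({0<..} \<times> {0..})"
  and transport_equation: "0 < x \<Longrightarrow> 0 \<le> t \<Longrightarrow> \<exists>D.
        ((\<lambda>s. c x s) has_real_derivative D) (at t within {0..}) \<and>
        ((\<lambda>y. (1 - y / CP_mean c t) * c y t) has_real_derivative D) (at x)"
  using sol by (auto simp: CP_solution_def)

lemma dilation_has_derivative:
  assumes "0 \<le> t"
  shows "(dilation c has_real_derivative dilation c t / CP_mean c t) (at t within {0..})"
proof -
  have "continuous_on {0..} (\<lambda>s. 1 / CP_mean c s)"
    using mean_pos by (intro continuous_intros mean_continuous) (auto simp: less_imp_neq[symmetric])
  from integral_has_real_derivative_half_line[OF this assms]
  show ?thesis
    unfolding dilation_def[abs_def] by (auto intro!: derivative_eq_intros)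
qed

lemma displacement_has_derivative:
  assumes "0 \<le> t"
  shows "(displacement c has_real_derivative 1 / dilation c t) (at t within {0..})"
proof -
  have "continuous_on {0..} (dilation c)"
    by (rule DERIV_continuous_on[where D = "\<lambda>t. dilation c t / CP_mean c t"])
       (auto intro: dilation_has_derivative)
  then have "continuous_on {0..} (\<lambda>s. 1 / dilation c s)"
    using dilation_pos by (intro continuous_intros) (auto simp: less_imp_neq[symmetric])
  from integral_has_real_derivative_half_line[OF this assms]
  show ?thesis by (simp add: displacement_def[abs_def])
qed

text \<open>
  Monotonicity ensures that a characteristic that is in \<open>x > 0\<close> at time \<open>t\<close> was there at all
  earlier times, so it can be followed back to the initial data.
\<close>
lemma displacement_mono:
  assumes "0 \<le> s" "s \<le> t" shows "displacement c s \<le> displacement c t"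
proof (rule DERIV_nonneg_imp_increasing_open[OF assms(2)])
  fix r assume "s < r" "r < t"
  with assms(1) have "0 < r" by simp
  then have "(displacement c has_real_derivative 1 / dilation c r) (at r)"
    using displacement_has_derivative[of r] by (simp add: at_within_interior[of r "{0..}"])
  then show "\<exists>D. (displacement c has_real_derivative D) (at r) \<and> 0 \<le> D"
    using dilation_pos[of c r] by (intro exI[of _ "1 / dilation c r"]) simp
next
  have "continuous_on {0..} (displacement c)"
    by (rule DERIV_continuous_on[where D = "\<lambda>t. 1 / dilation c t"])
       (auto intro: displacement_has_derivative)
  then show "continuous_on {s..t} (displacement c)"
    by (rule continuous_on_subset) (use assms in auto)
qed

text \<open>
  The product rule turns the conservative form of the equation into
  \<open>\<partial>\<^sub>t c = (1 - x / L) \<partial>\<^sub>x c - c / L\<close> with \<open>L = CP_mean c t\<close>, and the speed \<open>X' = X / L - 1\<close> cancels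
  the space derivative. Joint differentiability is what permits the chain rule along a curve.
\<close>
lemma decay_along_characteristic:
  assumes t: "t \<in> {0..u}"
    and X: "(X has_real_derivative X t / CP_mean c t - 1) (at t within {0..u})"
    and X_pos: "\<And>s. s \<in> {0..u} \<Longrightarrow> 0 < X s"
  shows "((\<lambda>s. c (X s) s) has_real_derivative - c (X t) t / CP_mean c t) (at t within {0..u})"
proof -
  let ?S = "{0<..} \<times> {0..} :: (real \<times> real) set"
  let ?f = "\<lambda>(x, t). c x t"
  define L where "L = CP_mean c t"
  define x where "x = X t"
  have x: "0 < x" and t0: "0 \<le> t" using X_pos[OF t] t by (auto simp: x_def)
  have L: "0 < L" using mean_pos t0 by (simp add: L_def)
  obtain f' where f': "(?f has_derivative f') (at (x, t) within ?S)"
    using jointly_differentiable x t0 unfolding differentiable_on_def differentiable_def by auto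
  interpret f': bounded_linear f' using f' by (rule has_derivative_bounded_linear)
  have lin: "f' (u, v) = u * f' (1, 0) + v * f' (0, 1)" for u v
    using f'.add[of "(u, 0)" "(0, v)"] f'.scaleR[of u "(1, 0)"] f'.scaleR[of v "(0, 1)"] by simp
  (* Besides the characteristic, the curves used are the two coordinate lines through (x, t):
     they identify the partial derivatives with the values of f' at the unit vectors. *)
  have curve: "((\<lambda>s. c (p s) (q s)) has_real_derivative p' * f' (1, 0) + q' * f' (0, 1)) (at r within I)"
    if p: "(p has_real_derivative p') (at r within I)" "p r = x"
      and q: "(q has_real_derivative q') (at r within I)" "q r = t"
      and I: "\<And>s. s \<in> I \<Longrightarrow> 0 < p s \<and> 0 \<le> q s" for p q p' q' r I
  proof -
    have "((\<lambda>s. (p s, q s)) has_derivative (\<lambda>h. (p' * h, q' * h))) (at r within I)"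
      using p(1) q(1) unfolding has_field_derivative_def by (intro has_derivative_Pair)
    moreover have "(?f has_derivative f') (at (p r, q r) within (\<lambda>s. (p s, q s)) ` I)"
      unfolding p(2) q(2) by (rule has_derivative_subset[OF f']) (use I in auto)
    ultimately have "((\<lambda>s. ?f (p s, q s)) has_derivative (\<lambda>h. f' (p' * h, q' * h))) (at r within I)"
      by (intro has_derivative_in_compose[where f = "\<lambda>s. (p s, q s)" and g = ?f]) auto
    moreover have "(\<lambda>h. f' (p' * h, q' * h)) = (*) (p' * f' (1, 0) + q' * f' (0, 1))"
      by (rule ext, subst lin) (simp add: algebra_simps)
    ultimately show ?thesis by (simp add: has_field_derivative_def)
  qed
  obtain D where D: "((\<lambda>s. c x s) has_real_derivative D) (at t within {0..})"
     "((\<lambda>y. (1 - y / L) * c y t) has_real_derivative D) (at x)"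
    using transport_equation[OF x t0] by (auto simp: L_def)
  have "((\<lambda>s. c x s) has_real_derivative 0 * f' (1, 0) + 1 * f' (0, 1)) (at t within {0..})"
    using x by (intro curve) auto
  then have "((\<lambda>s. c x s) has_real_derivative f' (0, 1)) (at t within {0..})" by simp
  moreover have "at t within {0..} \<noteq> bot"
  proof -
    have "at_right t \<le> at t within {0..}" using t0 by (intro at_le) auto
    then show ?thesis using trivial_limit_at_right_real[of t] le_bot by metis
  qed
  ultimately have dt: "f' (0, 1) = D"
    using D(1) by (intro has_field_derivative_unique)
  have "((\<lambda>y. c y t) has_real_derivative 1 * f' (1, 0) + 0 * f' (0, 1)) (at x within {0<..})"
    using t0 by (intro curve) auto
  then have "((\<lambda>y. c y t) has_real_derivative f' (1, 0)) (at x)"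
    using x by (simp add: at_within_open[of x "{0<..}"])
  then have "((\<lambda>y. (1 - y / L) * c y t) has_real_derivative
      (1 - x / L) * f' (1, 0) - c x t / L) (at x)"
    using L by (auto intro!: derivative_eq_intros)
  with D(2) have dx: "D = (1 - x / L) * f' (1, 0) - c x t / L"
    by (rule DERIV_unique)
  have "((\<lambda>s. c (X s) s) has_real_derivative (X t / L - 1) * f' (1, 0) + 1 * f' (0, 1)) (at t within {0..u})"
    using X X_pos by (intro curve) (auto simp: L_def x_def)
  moreover have "(X t / L - 1) * f' (1, 0) + 1 * f' (0, 1) = - c (X t) t / L"
    unfolding dt dx x_def by (simp add: algebra_simps)
  ultimately show ?thesis by (simp add: L_def)
qed

text \<open>
  Since \<open>c\<close> decays along characteristics at the rate at which \<open>dilation c\<close> grows, their product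
  is constant there.
\<close>
lemma solution_by_characteristics:
  assumes x: "0 < x" and t: "0 \<le> t"
  shows "c x t = c (x / dilation c t + displacement c t) 0 / dilation c t"
proof -
  define y where "y = x / dilation c t + displacement c t"
  define X where "X s = dilation c s * (y - displacement c s)" for s
  define \<phi> where "\<phi> s = dilation c s * c (X s) s" for s
  have X_pos: "0 < X s" if "s \<in> {0..t}" for s
  proof -
    have "displacement c s \<le> displacement c t" using that by (intro displacement_mono) auto
    moreover have "0 < x / dilation c t" using x dilation_pos by simp
    ultimately show ?thesis using dilation_pos[of c s] by (simp add: X_def y_def)
  qed
  have dil: "(dilation c has_real_derivative dilation c s / CP_mean c s) (at s within {0..t})"
    and dis: "(displacement c has_real_derivative 1 / dilation c s) (at s within {0..t})"
    if "s \<in> {0..t}" for s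
    using that by (auto intro!: DERIV_subset[OF dilation_has_derivative]
        DERIV_subset[OF displacement_has_derivative])
  have X': "(X has_real_derivative X s / CP_mean c s - 1) (at s within {0..t})"
    if "s \<in> {0..t}" for s
    unfolding X_def[abs_def] using dilation_pos[of c s]
    by (auto intro!: derivative_eq_intros dil[OF that] dis[OF that])
  have "(\<phi> has_real_derivative 0) (at s within {0..t})" if "s \<in> {0..t}" for s
    unfolding \<phi>_def[abs_def]
    by (auto intro!: derivative_eq_intros dil[OF that] decay_along_characteristic[OF that X'[OF that] X_pos])
  then have "\<exists>k. \<forall>s\<in>{0..t}. \<phi> s = k"
    by (intro has_field_derivative_zero_constant) auto
  then have "\<phi> t = \<phi> 0" using t by auto
  moreover have "X t = x" using dilation_pos[of c t] by (simp add: X_def y_def)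
  moreover have "X 0 = y" by (simp add: X_def dilation_0 displacement_0)
  ultimately show ?thesis
    using dilation_pos[of c t] by (simp add: \<phi>_def dilation_0 y_def field_simps)
qed

end

section \<open>Gaussian initial data\<close>
lemma set_integral_half_line_affine:
  fixes f :: "real \<Rightarrow> real"
  assumes "0 < d"
  shows "(LINT x:{0<..}|lborel. f (x / d + b)) = d * (LINT v:{b<..}|lborel. f v)"
proof -
  have "(LINT v:{b<..}|lborel. f v) =
      1 / d * (\<integral>x. indicator {b<..} (b + 1 / d * x) *\<^sub>R f (b + 1 / d * x) \<partial>lborel)"
    unfolding set_lebesgue_integral_def
    using assms by (subst lborel_integral_real_affine[of "1 / d" _ b]) auto
  also have "(\<lambda>x. indicator {b<..} (b + 1 / d * x) *\<^sub>R f (b + 1 / d * x)) =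
      (\<lambda>x. indicator {0<..} x *\<^sub>R f (x / d + b))"
    using assms by (auto simp: indicator_def add.commute zero_less_divide_iff)
  finally show ?thesis using assms by (simp add: set_lebesgue_integral_def)
qed

context
  fixes c :: "real \<Rightarrow> real \<Rightarrow> real" and K A B :: real and \<beta> :: "real \<Rightarrow> real"
  assumes sol: "CP_solution c" and K: "0 < K" and A: "0 < A"
    and initial: "\<And>x. 0 < x \<Longrightarrow> c x 0 = K * exp (- A * (x + B)\<^sup>2)"
  defines "\<beta> \<equiv> \<lambda>t. B + displacement c t"
begin

lemma solution_gaussian:
  assumes "0 < x" "0 \<le> t"
  shows "c x t = K / dilation c t * exp (- A * (x / dilation c t + \<beta> t)\<^sup>2)"
proof -
  have "0 \<le> displacement c t"
    using displacement_mono[OF sol, of 0 t] assms by (simp add: displacement_0)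
  moreover have "0 < x / dilation c t" using assms dilation_pos[of c t] by simp
  ultimately show ?thesis
    by (subst solution_by_characteristics[OF sol assms], subst initial)
       (auto simp: \<beta>_def add_ac)
qed

text \<open>
  The conservation law, read as an equation for the dilation. It closes the dynamics: the left
  side is the speed of the cutoff \<open>\<beta>\<close>.
\<close>
lemma dilation_eq:
  assumes "0 \<le> t" shows "1 / dilation c t = K * gaussian_excess A (\<beta> t)"
proof -
  let ?d = "dilation c t"
  have d: "0 < ?d" by (rule dilation_pos)
  have "1 = (LINT x:{0<..}|lborel. x * c x t)" using unit_mass[OF sol assms] by simp
  also have "\<dots> = (LINT x:{0<..}|lborel.
      K * ((x / ?d + \<beta> t - \<beta> t) * exp (- A * (x / ?d + \<beta> t)\<^sup>2)))"
    by (rule set_lebesgue_integral_cong) (auto simp: solution_gaussian assms)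
  also have "\<dots> = ?d * (LINT v:{\<beta> t<..}|lborel. K * ((v - \<beta> t) * exp (- A * v\<^sup>2)))"
    by (rule set_integral_half_line_affine[OF d])
  also have "\<dots> = ?d * (K * gaussian_excess A (\<beta> t))"
    by (simp add: gaussian_excess_def)
  finally show ?thesis using d by (simp add: field_simps)
qed

lemma mean_eq:
  assumes "0 \<le> t" shows "CP_mean c t = 1 / (K * gaussian_tail A (\<beta> t))"
proof -
  let ?d = "dilation c t"
  have d: "0 < ?d" by (rule dilation_pos)
  have "(LINT x:{0<..}|lborel. c x t) = (LINT x:{0<..}|lborel.
      K / ?d * exp (- A * (x / ?d + \<beta> t)\<^sup>2))"
    by (rule set_lebesgue_integral_cong) (auto simp: solution_gaussian assms)
  also have "\<dots> = ?d * (LINT v:{\<beta> t<..}|lborel. K / ?d * exp (- A * v\<^sup>2))"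
    by (rule set_integral_half_line_affine[OF d])
  also have "\<dots> = K * gaussian_tail A (\<beta> t)"
    using d by (simp add: gaussian_tail_def)
  finally show ?thesis by (simp add: CP_mean_def unit_mass[OF sol assms])
qed

lemma cutoff_has_derivative:
  assumes "0 < t"
  shows "(\<beta> has_real_derivative K * gaussian_excess A (\<beta> t)) (at t)"
proof -
  have "(displacement c has_real_derivative 1 / dilation c t) (at t)"
    using displacement_has_derivative[OF sol, of t] assms
    by (simp add: at_within_interior[of t "{0..}"])
  then show ?thesis
    unfolding \<beta>_def using dilation_eq[of t] assms
    by (auto intro!: derivative_eq_intros simp: \<beta>_def)
qed

lemma mean_has_derivative:
  assumes "0 < t"
  shows "(CP_mean c has_real_derivative
      exp (- A * (\<beta> t)\<^sup>2) * gaussian_excess A (\<beta> t) / (gaussian_tail A (\<beta> t))\<^sup>2) (at t)"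
proof -
  have "((\<lambda>s. gaussian_tail A (\<beta> s)) has_real_derivative
      - exp (- A * (\<beta> t)\<^sup>2) * (K * gaussian_excess A (\<beta> t))) (at t)"
    by (rule DERIV_chain2[OF gaussian_tail_has_derivative[OF A] cutoff_has_derivative[OF assms]])
  then have "((\<lambda>s. 1 / (K * gaussian_tail A (\<beta> s))) has_real_derivative
      exp (- A * (\<beta> t)\<^sup>2) * gaussian_excess A (\<beta> t) / (gaussian_tail A (\<beta> t))\<^sup>2) (at t)"
    using K gaussian_tail_pos[OF A, of "\<beta> t"]
    by (auto intro!: derivative_eq_intros simp: power2_eq_square)
  moreover have "\<forall>\<^sub>F s in nhds t. CP_mean c s = 1 / (K * gaussian_tail A (\<beta> s))"
    using eventually_nhds_in_open[of "{0<..}" t, simplified, OF assms]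
    by eventually_elim (simp add: mean_eq)
  ultimately show ?thesis by (subst DERIV_cong_ev[OF refl _ refl])
qed

text \<open>
  If the cutoff stayed below some \<open>M\<close>, its speed would stay above the positive constant
  \<open>K * gaussian_excess A M\<close>, forcing it past \<open>M\<close> in finite time.
\<close>
lemma cutoff_at_top: "filterlim \<beta> at_top at_top"
proof (rule ccontr)
  assume "\<not> filterlim \<beta> at_top at_top"
  then obtain M where M: "\<not> (\<forall>\<^sub>F t in at_top. M \<le> \<beta> t)"
    by (auto simp: filterlim_at_top)
  have bounded: "\<beta> t \<le> M" if "0 \<le> t" for t
  proof (rule ccontr)
    assume "\<not> \<beta> t \<le> M"
    moreover have "\<beta> t \<le> \<beta> s" if "t \<le> s" for s
      using displacement_mono[OF sol \<open>0 \<le> t\<close> that] by (simp add: \<beta>_def)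
    ultimately have "M \<le> \<beta> s" if "t \<le> s" for s using that by force
    with M show False by (auto simp: eventually_at_top_linorder)
  qed
  define v where "v = K * gaussian_excess A M"
  have v: "0 < v" using K gaussian_excess_pos[OF A] by (simp add: v_def)
  have "\<beta> 1 + v * (t - 1) \<le> \<beta> t" if "1 \<le> t" for t
  proof -
    have "\<beta> 1 - v * 1 \<le> \<beta> t - v * t"
    proof (rule DERIV_nonneg_imp_nondecreasing[OF that])
      fix s :: real assume "1 \<le> s"
      then have s: "0 < s" by simp
      have "gaussian_excess A M \<le> gaussian_excess A (\<beta> s)"
        using bounded[of s] s gaussian_excess_strict_antimono[OF A, of "\<beta> s" M]
        by (cases "\<beta> s = M") auto
      then have "0 \<le> K * gaussian_excess A (\<beta> s) - v"
        using K by (simp add: v_def)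
      moreover have "((\<lambda>s. \<beta> s - v * s) has_real_derivative K * gaussian_excess A (\<beta> s) - v) (at s)"
        by (auto intro!: derivative_eq_intros cutoff_has_derivative s)
      ultimately show "\<exists>D. ((\<lambda>s. \<beta> s - v * s) has_real_derivative D) (at s) \<and> 0 \<le> D"
        by blast
    qed
    then show ?thesis by (simp add: algebra_simps)
  qed
  (* At this time the linear lower bound is at least M + 1. *)
  moreover define t where "t = 1 + \<bar>M - \<beta> 1 + 1\<bar> / v"
  moreover have "1 \<le> t" using v by (simp add: t_def)
  ultimately have "\<beta> 1 + v * (t - 1) \<le> \<beta> t" by blast
  moreover have "v * (t - 1) = \<bar>M - \<beta> 1 + 1\<bar>" using v by (simp add: t_def)
  moreover have "0 \<le> t" using v by (simp add: t_def)
  ultimately show False using bounded[of t] by linarith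
qed

lemma mean_linear_growth:
  "\<forall>\<^sub>F t in at_top. CP_mean c t \<le> 2 * t \<and> t \<le> 4 * CP_mean c t"
proof -
  define D where "D b = exp (- A * b\<^sup>2) * gaussian_excess A b / (gaussian_tail A b)\<^sup>2" for b
  have "\<forall>\<^sub>F b in at_top. 15 \<le> A * b\<^sup>2 \<and> 0 < b"
    using A by (intro eventually_conj eventually_gt_at_top) real_asymp
  then have "\<forall>\<^sub>F b in at_top. 1 / 2 \<le> D b \<and> D b \<le> 1"
  proof eventually_elim
    case (elim b)
    define \<epsilon> where "\<epsilon> = 1 / (2 * A * b\<^sup>2)"
    have "0 < \<epsilon>" "\<epsilon> \<le> 1 / 30" using elim A by (auto simp: \<epsilon>_def field_simps)
    moreover from gaussian_excess_log_concavity[OF A, of b] elim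
    have "1 - 3 * \<epsilon> \<le> D b" "D b \<le> 1 - \<epsilon> / 2"
      unfolding D_def \<epsilon>_def by blast+
    ultimately have "1 / 2 \<le> D b" "D b \<le> 1" by linarith+
    then show ?case ..
  qed
  then have "\<forall>\<^sub>F t in at_top. 1 / 2 \<le> D (\<beta> t) \<and> D (\<beta> t) \<le> 1"
    by (rule eventually_compose_filterlim[OF _ cutoff_at_top])
  then obtain u where u: "\<And>t. u \<le> t \<Longrightarrow> 1 / 2 \<le> D (\<beta> t) \<and> D (\<beta> t) \<le> 1"
    by (auto simp: eventually_at_top_linorder)
  (* The formula for the derivative holds at positive times. *)
  define r where "r = max u 1"
  have der: "(CP_mean c has_real_derivative D (\<beta> s)) (at s)" "1 / 2 \<le> D (\<beta> s)" "D (\<beta> s) \<le> 1"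
    if "r \<le> s" for s
    using mean_has_derivative[of s] u[of s] that by (auto simp: r_def D_def)
  have upper: "CP_mean c t - t \<le> CP_mean c r - r" if "r \<le> t" for t
  proof (rule DERIV_nonpos_imp_nonincreasing[OF that])
    fix s assume "r \<le> s"
    then show "\<exists>y. ((\<lambda>t. CP_mean c t - t) has_real_derivative y) (at s) \<and> y \<le> 0"
      by (intro exI[of _ "D (\<beta> s) - 1"]) (auto intro!: derivative_eq_intros der)
  qed
  have lower: "CP_mean c r - r / 2 \<le> CP_mean c t - t / 2" if "r \<le> t" for t
  proof (rule DERIV_nonneg_imp_nondecreasing[OF that])
    fix s assume "r \<le> s"
    then show "\<exists>y. ((\<lambda>t. CP_mean c t - t / 2) has_real_derivative y) (at s) \<and> 0 \<le> y"
      using der[of s] by (intro exI[of _ "D (\<beta> s) - 1 / 2"]) (auto intro!: derivative_eq_intros)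
  qed
  have "0 < CP_mean c r" using mean_pos[OF sol] by (simp add: r_def)
  have "1 \<le> r" by (simp add: r_def)
  show ?thesis
    (* Past this time the initial values at r are negligible against t. *)
    using eventually_ge_at_top[of "r + CP_mean c r + 2 * r"]
  proof eventually_elim
    case (elim t)
    then have "r \<le> t" using \<open>1 \<le> r\<close> \<open>0 < CP_mean c r\<close> by linarith
    from upper[OF this] lower[OF this]
    have "CP_mean c t \<le> 2 * t" "t \<le> 4 * CP_mean c t"
      using elim \<open>1 \<le> r\<close> \<open>0 < CP_mean c r\<close> by linarith+
    then show ?case ..
  qed
qed

text \<open>
  The mean \<open>1 / (K T(\<beta>))\<close> equals \<open>exp (A \<beta>\<^sup>2)\<close> up to a factor linear in \<open>\<beta>\<close>, which the slack between
  \<open>exp (A \<beta>\<^sup>2 / 2)\<close> and \<open>exp (2 A \<beta>\<^sup>2)\<close> absorbs together with all constants; the linear growth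
  of the mean then replaces it by \<open>t\<close>.
\<close>
lemma cutoff_log_growth:
  "\<forall>\<^sub>F t in at_top. A * (\<beta> t)\<^sup>2 / 2 \<le> ln t \<and> ln t \<le> 2 * (A * (\<beta> t)\<^sup>2)"
proof -
  have "\<forall>\<^sub>F b in at_top. 15 \<le> A * b\<^sup>2 \<and> 0 < b"
    using A by (intro eventually_conj eventually_gt_at_top) real_asymp
  moreover have "\<forall>\<^sub>F b in at_top. exp (A * b\<^sup>2 / 2) \<le> A * b / K * exp (A * b\<^sup>2)"
    using A K by real_asymp
  moreover have "\<forall>\<^sub>F b in at_top. 16 * A * b / K * exp (A * b\<^sup>2) \<le> exp (2 * (A * b\<^sup>2))"
    using A K by real_asymp
  ultimately have "\<forall>\<^sub>F b in at_top. 2 * exp (A * b\<^sup>2 / 2) \<le> 1 / (K * gaussian_tail A b) \<and>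
      4 * (1 / (K * gaussian_tail A b)) \<le> exp (2 * (A * b\<^sup>2))"
  proof eventually_elim
    case (elim b)
    let ?T = "gaussian_tail A b" and ?E = "exp (A * b\<^sup>2)"
    have T: "0 < ?T" by (rule gaussian_tail_pos[OF A])
    have "?T \<le> 1 / (?E * (2 * A * b))" "1 / (?E * (4 * A * b)) \<le> ?T"
      using gaussian_tail_coarse_bounds[OF A, of b] elim by (auto simp: exp_minus field_simps)
    then have "2 * (A * b / K * ?E) \<le> 1 / (K * ?T)" "4 * (1 / (K * ?T)) \<le> 16 * A * b / K * ?E"
      using T K A elim by (auto simp: field_simps)
    with elim show ?case by linarith
  qed
  then have "\<forall>\<^sub>F t in at_top. 2 * exp (A * (\<beta> t)\<^sup>2 / 2) \<le> 1 / (K * gaussian_tail A (\<beta> t)) \<and>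
      4 * (1 / (K * gaussian_tail A (\<beta> t))) \<le> exp (2 * (A * (\<beta> t)\<^sup>2))"
    by (rule eventually_compose_filterlim[OF _ cutoff_at_top])
  then show ?thesis
    using mean_linear_growth eventually_gt_at_top[of 0]
  proof eventually_elim
    case (elim t)
    then have "exp (A * (\<beta> t)\<^sup>2 / 2) \<le> t" "t \<le> exp (2 * (A * (\<beta> t)\<^sup>2))"
      using mean_eq[of t] by auto
    then show ?case using \<open>0 < t\<close> ln_mono[of t "exp (2 * (A * (\<beta> t)\<^sup>2))"]
        ln_ge_iff[of t "A * (\<beta> t)\<^sup>2 / 2"] by simp
  qed
qed

text \<open>
  With \<open>\<epsilon> = 1 / (2 A \<beta>\<^sup>2)\<close> the logarithmic growth of the cutoff says
  \<open>1 / (4 ln t) \<le> \<epsilon> \<le> 1 / ln t\<close>, whence the constants \<open>3\<close> and \<open>1 / 8\<close>.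
\<close>
lemma mean_derivative_bounds:
  "\<forall>\<^sub>F t in at_top. \<exists>D. (CP_mean c has_real_derivative D) (at t) \<and>
     1 - 3 / ln t \<le> D \<and> D \<le> 1 - (1 / 8) / ln t"
proof -
  have "\<forall>\<^sub>F b in at_top. 15 \<le> A * b\<^sup>2 \<and> 0 < b"
    using A by (intro eventually_conj eventually_gt_at_top) real_asymp
  then have "\<forall>\<^sub>F t in at_top. 15 \<le> A * (\<beta> t)\<^sup>2 \<and> 0 < \<beta> t"
    by (rule eventually_compose_filterlim[OF _ cutoff_at_top])
  then show ?thesis
    using cutoff_log_growth eventually_gt_at_top[of 0]
  proof eventually_elim
    case (elim t)
    define \<epsilon> where "\<epsilon> = 1 / (2 * A * (\<beta> t)\<^sup>2)"
    have "0 < ln t" using elim by linarith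
    then have "\<epsilon> \<le> 1 / ln t" "(1 / 4) / ln t \<le> \<epsilon>"
      using elim A by (auto simp: \<epsilon>_def field_simps)
    then have "1 - 3 / ln t \<le> 1 - 3 * \<epsilon>" "1 - \<epsilon> / 2 \<le> 1 - (1 / 8) / ln t" by auto
    moreover note gaussian_excess_log_concavity[OF A, of "\<beta> t", folded \<epsilon>_def]
    ultimately show ?case
      using mean_has_derivative[of t] elim by (meson order_trans)
  qed
qed

end

theorem proposition2p1:
  fixes c0 :: "real \<Rightarrow> real \<Rightarrow> real" and K0 A0 B0 :: real
  assumes "0 < K0" and "0 < A0"
    and "CP_solution c0"
    and "\<forall>x>0. c0 x 0 = K0 * exp (- A0 * (x + B0)\<^sup>2)"
    and "(LINT x:{0<..}|lborel. x * c0 x 0) = 1"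
  shows "\<exists>t0>2. \<exists>C1>0. \<exists>C2>0. \<forall>t\<ge>t0.
           \<exists>D. (CP_mean c0 has_real_derivative D) (at t) \<and>
               1 - C1 / ln t \<le> D \<and> D \<le> 1 - C2 / ln t"
proof -
  obtain u where u: "\<And>t. u \<le> t \<Longrightarrow> \<exists>D. (CP_mean c0 has_real_derivative D) (at t) \<and>
      1 - 3 / ln t \<le> D \<and> D \<le> 1 - (1 / 8) / ln t"
    using mean_derivative_bounds[OF assms(3,1,2), of B0] assms(4)
    unfolding eventually_at_top_linorder by blast
  show ?thesis
    by (rule exI[of _ "max u 3"], rule conjI, simp, rule exI[of _ 3], rule conjI, simp,
        rule exI[of _ "1 / 8"], rule conjI, simp) (use u in auto)
qed

end
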